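(* Let $A=\{1,\dots,30\}$ and $C=\{31,\dots,60\}$. For $1\le i\le 15$ let $P_i=\{2i-1,2i\}$, and for $1\le j\le 15$ let $Q_j=\{30+2j-1,30+2j\}$. Define \[ \mathcal{B}_A=\{P_i\cup P_j\cup P_k:1\le i<j<k\le 15\},\qquad \mathcal{B}_C=\{Q_i\cup Q_j\cup Q_k:1\le i<j<k\le 15\}, \] and for $1\le m\le 10$ let $G_m=\{6m-5,6m-4,\dots,6m\}$. Let $\mathcal{B}=\mathcal{B}_A\cup\mathcal{B}_C\cup\{G_1,\dots,G_{10}\}$, a family of $920$ subsets of $\{1,\dots,60\}$, each of size $6$. Then for every subset $S\subset\{1,\dots,60\}$ with $|S|=6$, there exists $B\in\mathcal{B}$ such that $|S\cap B|\ge 3$.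
   Formalization: The count 920 = 455+455+10 is taken with multiplicity: each G_m already lies in B_A (m ≤ 5) or B_C (m ≥ 6), so the union B as a set has only 910 distinct members; the covering property is proved for this set. *)

theory Defs
  imports Main "HOL-Library.Multiset"
begin

definition pairP :: "nat \<Rightarrow> nat set" where
  "pairP i = {2 * i - 1, 2 * i}"

definition pairQ :: "nat \<Rightarrow> nat set" where
  "pairQ j = {30 + 2 * j - 1, 30 + 2 * j}"

definition blocksA :: "nat set set" where
  "blocksA = {pairP i \<union> pairP j \<union> pairP k | i j k. 1 \<le> i \<and> i < j \<and> j < k \<and> k \<le> 15}"

definition blocksC :: "nat set set" where
  "blocksC = {pairQ i \<union> pairQ j \<union> pairQ k | i j k. 1 \<le> i \<and> i < j \<and> j < k \<and> k \<le> 15}"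

definition groupG :: "nat \<Rightarrow> nat set" where
  "groupG m = {6 * m - 5..6 * m}"

definition blocksG :: "nat set set" where
  "blocksG = {groupG m | m. 1 \<le> m \<and> m \<le> 10}"

definition blocks :: "nat set set" where
  "blocks = blocksA \<union> blocksC \<union> blocksG"

(* The number of blocks, 920 = 455 + 455 + 10, is a count with multiplicity: every
   groupG m with m \<le> 5 is the union of pairP (3 * m - 2), pairP (3 * m - 1) and pairP (3 * m),
   hence already in blocksA, and likewise groupG m with 6 \<le> m \<le> 10 is in blocksC.
   So the set blocks has only 910 elements, and the family of 920 sets is this multiset.
   Each of the three summands is a finite set; mset_set of an infinite set would be empty. *)
definition block_family :: "nat set multiset" where
  "block_family = mset_set blocksA + mset_set blocksC + mset_set blocksG"

end

theory Submission
  imports Defs "HOL-Library.Disjoint_Sets"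
begin

text \<open>
  Any \<open>S\<close> with six points has at least three of them in one of the halves \<open>{1..30}\<close>, \<open>{31..60}\<close>.
  Three points of a half meet at most three of its fifteen pairs, so they all lie in a union of
  three pairs, which is a block.
\<close>

text \<open>The common shape of \<open>blocksA\<close> and \<open>blocksC\<close>, abstracted over
  the indexed family, so that finiteness, counting and covering are proved once and serve both
  halves.\<close>

definition triple_unions :: "(nat \<Rightarrow> 'a set) \<Rightarrow> nat \<Rightarrow> 'a set set" where
  "triple_unions p n = {p i \<union> p j \<union> p k | i j k. 1 \<le> i \<and> i < j \<and> j < k \<and> k \<le> n}"

lemma card_3_sortedE:
  fixes I :: "'a::linorder set"
  assumes "card I = 3"
  obtains i j k where "i < j" "j < k" "I = {i, j, k}"
proof -
  obtain a b c where I: "I = {a, b, c}" and "a \<noteq> b" "a \<noteq> c" "b \<noteq> c"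
    using assms by (auto simp: card_3_iff)
  then consider "a < b" "b < c" | "a < c" "c < b" | "b < a" "a < c"
    | "b < c" "c < a" | "c < a" "a < b" | "c < b" "b < a"
    by (metis linorder_neqE)
  then show ?thesis
    by cases (rule that, assumption, assumption, simp add: I insert_commute)+
qed

text \<open>Trading increasing index triples for three-element index sets removes the ordering:
  counting becomes counting subsets, and a covering block can be given by any suitable index
  set.\<close>

lemma triple_unions_eq_image:
  "triple_unions p n = (\<lambda>I. \<Union> (p ` I)) ` {I. I \<subseteq> {1..n} \<and> card I = 3}" (is "?L = ?R")
proof
  show "?L \<subseteq> ?R"
  proof
    fix B assume "B \<in> ?L"
    then obtain i j k where B: "B = p i \<union> p j \<union> p k" and "1 \<le> i" "i < j" "j < k" "k \<le> n"
      unfolding triple_unions_def by blast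
    then have "{i, j, k} \<in> {I. I \<subseteq> {1..n} \<and> card I = 3}"
      by auto
    moreover have "B = \<Union> (p ` {i, j, k})"
      using B by auto
    ultimately show "B \<in> ?R" by blast
  qed
  show "?R \<subseteq> ?L"
  proof
    fix B assume "B \<in> ?R"
    then obtain I where I: "I \<subseteq> {1..n}" "card I = 3" and B: "B = \<Union> (p ` I)"
      by blast
    obtain i j k where "i < j" "j < k" "I = {i, j, k}"
      using I(2) by (rule card_3_sortedE)
    moreover from this have "B = p i \<union> p j \<union> p k"
      using B by auto
    ultimately show "B \<in> ?L"
      using I(1) unfolding triple_unions_def by auto
  qed
qed

text \<open>The index set can be read off from the union: an index in \<open>J\<close> belongs to
  \<open>I\<close> exactly when its member meets the union over \<open>I\<close>. Nonemptiness gives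
  one direction, disjointness the other.\<close>

lemma inj_on_UN_disjoint:
  assumes "disjoint_family_on p J" and "\<And>i. i \<in> J \<Longrightarrow> p i \<noteq> {}"
  shows "inj_on (\<lambda>I. \<Union> (p ` I)) (Pow J)"
proof (rule inj_onI)
  have *: "i \<in> I \<longleftrightarrow> i \<in> J \<and> p i \<inter> \<Union> (p ` I) \<noteq> {}" if "I \<subseteq> J" for i I
  proof
    assume "i \<in> I"
    with that have "i \<in> J" by blast
    with assms(2) \<open>i \<in> I\<close> show "i \<in> J \<and> p i \<inter> \<Union> (p ` I) \<noteq> {}" by blast
  next
    assume i: "i \<in> J \<and> p i \<inter> \<Union> (p ` I) \<noteq> {}"
    then obtain j where "j \<in> I" "p i \<inter> p j \<noteq> {}" by blast
    moreover from this have "j \<in> J" using that by blast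
    ultimately show "i \<in> I"
      using i assms(1) unfolding disjoint_family_on_def by metis
  qed
  fix I I' assume "I \<in> Pow J" "I' \<in> Pow J" and eq: "\<Union> (p ` I) = \<Union> (p ` I')"
  then have "I \<subseteq> J" "I' \<subseteq> J" by auto
  then show "I = I'"
    unfolding set_eq_iff *[OF \<open>I \<subseteq> J\<close>] *[OF \<open>I' \<subseteq> J\<close>] eq by (intro allI refl)
qed

lemma finite_triple_unions: "finite (triple_unions p n)"
  unfolding triple_unions_eq_image by simp

lemma card_triple_unions:
  assumes "disjoint_family_on p {1..n}" and "\<And>i. i \<in> {1..n} \<Longrightarrow> p i \<noteq> {}"
  shows "card (triple_unions p n) = n choose 3"
proof -
  have "inj_on (\<lambda>I. \<Union> (p ` I)) {I. I \<subseteq> {1..n} \<and> card I = 3}"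
    by (rule inj_on_subset[OF inj_on_UN_disjoint[OF assms]]) auto
  then show ?thesis
    unfolding triple_unions_eq_image by (simp add: card_image n_subsets)
qed

lemma card_member_triple_unions:
  assumes "disjoint_family_on p {1..n}" and "\<And>i. i \<in> {1..n} \<Longrightarrow> card (p i) = c" and "c > 0"
    and "B \<in> triple_unions p n"
  shows "card B = 3 * c"
proof -
  obtain I where I: "I \<subseteq> {1..n}" "card I = 3" and B: "B = \<Union> (p ` I)"
    using assms(4) unfolding triple_unions_eq_image by blast
  have "finite I"
    using I(1) finite_subset by blast
  moreover have "\<forall>i\<in>I. finite (p i)"
    \<comment> \<open>Infinite sets have \<open>card\<close> equal to 0, so the positive value
      \<open>c\<close> forces each member to be finite.\<close>
    using I(1) assms(2,3) by (metis card_ge_0_finite subsetD)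
  moreover have "\<forall>i\<in>I. \<forall>j\<in>I. i \<noteq> j \<longrightarrow> p i \<inter> p j = {}"
    using I(1) assms(1) unfolding disjoint_family_on_def by blast
  ultimately have "card B = (\<Sum>i\<in>I. card (p i))"
    unfolding B by (rule card_UN_disjoint)
  also have "\<dots> = (\<Sum>i\<in>I. c)"
    using I(1) assms(2) by (intro sum.cong) auto
  finally show ?thesis
    using I(2) by simp
qed

text \<open>Choosing for each point of \<open>T\<close> an index of a member that contains it
  produces at most three indices.\<close>

lemma ex_triple_union_superset:
  assumes "T \<subseteq> \<Union> (p ` {1..n})" and "card T = 3" and "n \<ge> 3"
  obtains B where "B \<in> triple_unions p n" "T \<subseteq> B"
proof -
  have "\<forall>t\<in>T. \<exists>i. i \<in> {1..n} \<and> t \<in> p i"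
    using assms(1) by blast
  then obtain f where f: "\<forall>t\<in>T. f t \<in> {1..n} \<and> t \<in> p (f t)"
    by metis
  have "finite T"
    using assms(2) card_ge_0_finite by force
  then have "card (f ` T) \<le> 3"
    using card_image_le assms(2) by metis
  moreover have "f ` T \<subseteq> {1..n}"
    using f by blast
  \<comment> \<open>Points of \<open>T\<close> may share a member, so the chosen indices may number
    fewer than three; they are padded to exactly three, for which \<open>{1..n}\<close> has room
    because \<open>n \<ge> 3\<close>.\<close>
  ultimately obtain I where "f ` T \<subseteq> I" "I \<subseteq> {1..n}" "card I = 3"
    using exists_subset_between[of "f ` T" 3 "{1..n}"] assms(3) by auto
  then show ?thesis
    using that[of "\<Union> (p ` I)"] f unfolding triple_unions_eq_image by blast
qed

lemma ex_triple_union_inter: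
  assumes "card (S \<inter> \<Union> (p ` {1..n})) \<ge> 3" and "n \<ge> 3" and "finite S"
  obtains B where "B \<in> triple_unions p n" "card (S \<inter> B) \<ge> 3"
proof -
  obtain T where T: "T \<subseteq> S \<inter> \<Union> (p ` {1..n})" "card T = 3"
    using obtain_subset_with_card_n[OF assms(1)] by metis
  then obtain B where B: "B \<in> triple_unions p n" "T \<subseteq> B"
    using ex_triple_union_superset[of T p n] assms(2) by blast
  have "card T \<le> card (S \<inter> B)"
    using T(1) B(2) assms(3) by (intro card_mono) auto
  with B(1) T(2) that show ?thesis by simp
qed

lemma blocksA_eq: "blocksA = triple_unions pairP 15"
  unfolding blocksA_def triple_unions_def ..

lemma blocksC_eq: "blocksC = triple_unions pairQ 15"
  unfolding blocksC_def triple_unions_def ..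

lemma blocksG_eq: "blocksG = groupG ` {1..10}"
  unfolding blocksG_def by auto

lemma disjoint_pairP: "disjoint_family_on pairP {1..n}"
  unfolding disjoint_family_on_def
proof (intro ballI impI)
  \<comment> \<open>Rounding up \<open>x / 2\<close> sends both \<open>2 * i - 1\<close> and
    \<open>2 * i\<close> to \<open>i\<close>, so a point determines its pair.\<close>
  have *: "i = (x + 1) div 2" if "x \<in> pairP i" "i \<in> {1..n}" for i x
    using that unfolding pairP_def by auto
  show "pairP i \<inter> pairP j = {}" if "i \<in> {1..n}" "j \<in> {1..n}" "i \<noteq> j" for i j
    using that *[of _ i] *[of _ j] by blast
qed

text \<open>Carries facts on the first half over to the second by the injective shift by 30. The
  index 0 must be excluded: truncated subtraction makes \<open>pairP 0\<close> the singleton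
  \<open>{0}\<close>, while \<open>pairQ 0\<close> is \<open>{29, 30}\<close>.\<close>

lemma pairQ_eq_image: "1 \<le> j \<Longrightarrow> pairQ j = (+) 30 ` pairP j"
  unfolding pairP_def pairQ_def by auto

lemma disjoint_pairQ: "disjoint_family_on pairQ {1..n}"
  using disjoint_pairP[of n] unfolding disjoint_family_on_def
  by (simp add: pairQ_eq_image flip: image_Int)

lemma card_pairP: "1 \<le> i \<Longrightarrow> card (pairP i) = 2"
  unfolding pairP_def by (simp add: card_insert_if)

lemma card_pairQ: "1 \<le> j \<Longrightarrow> card (pairQ j) = 2"
  by (simp add: pairQ_eq_image card_image card_pairP)

lemma UN_pairP: "\<Union> (pairP ` {1..n}) = {1..2 * n}"
proof
  show "\<Union> (pairP ` {1..n}) \<subseteq> {1..2 * n}"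
    unfolding pairP_def by auto
  show "{1..2 * n} \<subseteq> \<Union> (pairP ` {1..n})"
  proof
    fix x assume "x \<in> {1..2 * n}"
    \<comment> \<open>The two alternatives are \<open>x\<close> odd and \<open>x\<close>
      even.\<close>
    then have "(x + 1) div 2 \<in> {1..n}" "x = 2 * ((x + 1) div 2) - 1 \<or> x = 2 * ((x + 1) div 2)"
      by auto
    then have "(x + 1) div 2 \<in> {1..n}" "x \<in> pairP ((x + 1) div 2)"
      unfolding pairP_def by blast+
    then show "x \<in> \<Union> (pairP ` {1..n})" by blast
  qed
qed

lemma UN_pairQ: "\<Union> (pairQ ` {1..n}) = {31..30 + 2 * n}"
proof -
  have "\<Union> (pairQ ` {1..n}) = (+) 30 ` \<Union> (pairP ` {1..n})"
    by (simp add: image_UN pairQ_eq_image)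
  then show ?thesis
    by (simp only: UN_pairP image_add_atLeastAtMost) simp
qed

lemma triple_unions_subset: "B \<in> triple_unions p n \<Longrightarrow> B \<subseteq> \<Union> (p ` {1..n})"
  unfolding triple_unions_eq_image by blast

lemma card_blocksA: "card blocksA = 455" and card_blocksC: "card blocksC = 455"
proof -
  have "(15::nat) choose 3 = 455"
    by (simp add: numeral_eq_Suc)
  moreover have "pairP i \<noteq> {}" "pairQ i \<noteq> {}" for i
    unfolding pairP_def pairQ_def by auto
  ultimately show "card blocksA = 455" "card blocksC = 455"
    unfolding blocksA_eq blocksC_eq
    by (simp_all add: card_triple_unions[OF disjoint_pairP] card_triple_unions[OF disjoint_pairQ])
qed

lemma card_blocksG: "card blocksG = 10"
proof -
  \<comment> \<open>Each interval is nonempty, so it determines its upper endpoint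
    \<open>6 * m\<close> and hence \<open>m\<close>.\<close>
  have "inj_on groupG {1..10}"
    unfolding groupG_def by (rule inj_onI) auto
  then show ?thesis
    unfolding blocksG_eq by (simp add: card_image)
qed

text \<open>Needed to recover the elements of \<open>block_family\<close>, since
  \<open>mset_set\<close> returns the empty multiset on an infinite set.\<close>

lemma finite_blocks_parts: "finite blocksA" "finite blocksC" "finite blocksG"
  unfolding blocksA_eq blocksC_eq blocksG_eq by (simp_all add: finite_triple_unions)

lemma block_subset_card:
  assumes "B \<in> blocks"
  shows "B \<subseteq> {1..60} \<and> card B = 6"
proof -
  consider "B \<in> blocksA" | "B \<in> blocksC" | "B \<in> blocksG"
    using assms unfolding blocks_def by blast
  then show ?thesis
  proof cases
    case 1
    then have B: "B \<in> triple_unions pairP 15"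
      by (simp add: blocksA_eq)
    then have "B \<subseteq> {1..30}"
      using triple_unions_subset UN_pairP[of 15] by fastforce
    moreover have "card B = 3 * 2"
      by (rule card_member_triple_unions[OF disjoint_pairP _ _ B]) (auto simp: card_pairP)
    ultimately show ?thesis by auto
  next
    case 2
    then have B: "B \<in> triple_unions pairQ 15"
      by (simp add: blocksC_eq)
    then have "B \<subseteq> {31..60}"
      using triple_unions_subset UN_pairQ[of 15] by fastforce
    moreover have "card B = 3 * 2"
      by (rule card_member_triple_unions[OF disjoint_pairQ _ _ B]) (auto simp: card_pairQ)
    ultimately show ?thesis by auto
  next
    case 3
    then show ?thesis
      unfolding blocksG_eq groupG_def by auto
  qed
qed

lemma ex_block_inter:
  assumes S: "S \<subseteq> {1..60}" "card S = 6"
  shows "\<exists>B\<in>blocks. card (S \<inter> B) \<ge> 3"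
proof -
  have fin: "finite S"
    using S(1) finite_subset by blast
  have "S = (S \<inter> {1..30}) \<union> (S \<inter> {31..60})"
    using S(1) by auto
  then have "6 \<le> card (S \<inter> {1..30}) + card (S \<inter> {31..60})"
    using card_Un_le[of "S \<inter> {1..30}" "S \<inter> {31..60}"] S(2) by simp
  \<comment> \<open>Two counts of at most 2 would sum to at most 4, short of 6.\<close>
  then consider "card (S \<inter> {1..30}) \<ge> 3" | "card (S \<inter> {31..60}) \<ge> 3"
    by linarith
  then show ?thesis
  proof cases
    case 1
    then have "card (S \<inter> \<Union> (pairP ` {1..15})) \<ge> 3"
      unfolding UN_pairP by simp
    from ex_triple_union_inter[OF this _ fin] show ?thesis
      unfolding blocks_def blocksA_eq by auto
  next
    case 2
    then have "card (S \<inter> \<Union> (pairQ ` {1..15})) \<ge> 3"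
      unfolding UN_pairQ by simp
    from ex_triple_union_inter[OF this _ fin] show ?thesis
      unfolding blocks_def blocksC_eq by auto
  qed
qed

theorem theorem3p1:
  shows "size block_family = 920
    \<and> set_mset block_family = blocks
    \<and> (\<forall>B \<in> blocks. B \<subseteq> {1..60} \<and> card B = 6)
    \<and> (\<forall>S :: nat set. S \<subseteq> {1..60} \<and> card S = 6 \<longrightarrow> (\<exists>B \<in> blocks. card (S \<inter> B) \<ge> 3))"
proof (intro conjI ballI allI impI)
  show "size block_family = 920"
    \<comment> \<open>Sizes add under multiset sum even when the summands share blocks, giving 455 +
      455 + 10.\<close>
    unfolding block_family_def by (simp add: card_blocksA card_blocksC card_blocksG)
  show "set_mset block_family = blocks"
    unfolding block_family_def blocks_def by (simp add: finite_blocks_parts)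
qed (use block_subset_card ex_block_inter in auto)

end
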